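(* Let $S_h^{01}(\omega)=S_h^1(\omega)S_h^0(\omega)$ be the iteration operator of the two-color relaxation built from a point relaxation with Fourier symbols $\tilde{S}_h^\beta(\vec{\theta},\omega)$, $\beta=0,1$. Then $S_h^{01}(\omega)$ leaves each subspace of $2h$-harmonics invariant: for every $\vec{\theta}\in\Theta_{low}=(-\frac{\pi}{2},\frac{\pi}{2}]^2$, $$S_h^{01}(\omega)\,F_{2h}^2(\vec{\theta})\subseteq F_{2h}^2(\vec{\theta}).$$
   Context: The infinite grid is $G_h=\{(k_1h,k_2h)\mid (k_1,k_2)\in\mathbb{Z}^2\}$ with mesh size $h>0$. It is split as $G_h=G_h^0\cup G_h^1$, where $G_h^\beta=\{(k_1h,k_2h)\mid k_1+k_2\equiv\beta \bmod 2\}$ for $\beta=0,1$ (red and black points). The Fourier modes are $\varphi_h(\vec{\theta},\vec{x})=\exp(i\vec{\theta}\cdot\vec{x}/h)$ for $\vec{\theta}\in\Theta=(-\pi,\pi]^2$ and $\vec{x}\in G_h$. For $\vec{\theta}\in\Theta_{low}$ and $\alpha\in\{0,1\}$, $\vec{\theta}^\alpha=(\vec{\theta}+(\alpha,\alpha)\pi)\bmod 2\pi$, with components reduced to $(-\pi,\pi]$. The subspace of $2h$-harmonics is $F_{2h}^2(\vec{\theta})=\mathrm{span}\{\varphi_h(\vec{\theta}^0,\cdot),\varphi_h(\vec{\theta}^1,\cdot)\}$, a space of complex-valued functions on $G_h$. Two-color relaxation: the partial step $S_h^\beta(\omega)$ (with relaxation parameter $\omega$) is a linear operator on complex grid functions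 on $G_h$ that applies the point relaxation at the points of $G_h^\beta$ and leaves the values at the other points unchanged. On Fourier modes it acts, for all $\vec{\theta}\in\Theta$, by $$(S_h^\beta(\omega)\varphi_h(\vec{\theta},\cdot))(\vec{x})=\begin{cases}\tilde{S}_h^\beta(\vec{\theta},\omega)\,\varphi_h(\vec{\theta},\vec{x}), & \vec{x}\in G_h^\beta,\\ \varphi_h(\vec{\theta},\vec{x}), & \vec{x}\in G_h\setminus G_h^\beta,\end{cases}$$ where $\tilde{S}_h^\beta(\vec{\theta},\omega)\in\mathbb{C}$ is the Fourier symbol of the point relaxation on $G_h^\beta$. *)

theory Defs
  imports "HOL-Analysis.Analysis" "HOL-Library.Function_Algebras"
begin

definition grid :: "real \<Rightarrow> (real \<times> real) set" where
  "grid h = {(of_int k1 * h, of_int k2 * h) | k1 k2 :: int. True}"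

definition color_grid :: "real \<Rightarrow> int \<Rightarrow> (real \<times> real) set" where
  "color_grid h \<beta> = {(of_int k1 * h, of_int k2 * h) | k1 k2 :: int. (k1 + k2) mod 2 = \<beta> mod 2}"

lemma grid_split: "grid h = color_grid h 0 \<union> color_grid h 1"
  unfolding grid_def color_grid_def
  by (auto, metis even_iff_mod_2_eq_zero odd_iff_mod_2_eq_one)

(* Complex functions on the grid are represented by functions on the plane vanishing off the
   grid, so that equality of grid functions is equality in HOL. *)
type_synonym gfun = "real \<times> real \<Rightarrow> complex"

definition grid_functions :: "real \<Rightarrow> gfun set" where
  "grid_functions h = {u. \<forall>x. x \<notin> grid h \<longrightarrow> u x = 0}"

definition cscale :: "complex \<Rightarrow> gfun \<Rightarrow> gfun" where
  "cscale c u = (\<lambda>x. c * u x)"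

global_interpretation gfun: vector_space cscale
  by unfold_locales (auto simp: cscale_def fun_eq_iff algebra_simps)

lemma subspace_grid_functions: "gfun.subspace (grid_functions h)"
  by (auto simp: gfun.subspace_def grid_functions_def cscale_def)

(* The library predicate Vector_Spaces.linear concerns maps on a whole type; this is
   linearity for operators on the subspace of grid functions. *)
definition grid_operator :: "real \<Rightarrow> (gfun \<Rightarrow> gfun) \<Rightarrow> bool" where
  "grid_operator h T \<longleftrightarrow>
     (\<forall>u\<in>grid_functions h. T u \<in> grid_functions h) \<and>
     (\<forall>u\<in>grid_functions h. \<forall>v\<in>grid_functions h. T (u + v) = T u + T v) \<and>
     (\<forall>c. \<forall>u\<in>grid_functions h. T (cscale c u) = cscale c (T u))"

definition frequencies :: "(real \<times> real) set" where
  "frequencies = {-pi<..pi} \<times> {-pi<..pi}"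

definition low_frequencies :: "(real \<times> real) set" where
  "low_frequencies = {-(pi/2)<..pi/2} \<times> {-(pi/2)<..pi/2}"

definition fourier_mode :: "real \<Rightarrow> real \<times> real \<Rightarrow> gfun" where
  "fourier_mode h \<theta> =
     (\<lambda>x. if x \<in> grid h then exp (\<i> * complex_of_real (\<theta> \<bullet> x / h)) else 0)"

lemma fourier_mode_in_grid_functions: "fourier_mode h \<theta> \<in> grid_functions h"
  by (simp add: fourier_mode_def grid_functions_def)

definition reduce_angle :: "real \<Rightarrow> real" where
  "reduce_angle t = t - 2 * pi * of_int \<lceil>(t - pi) / (2 * pi)\<rceil>"

lemma reduce_angle_range: "reduce_angle t \<in> {-pi<..pi}"
proof -
  define c where "c = (of_int \<lceil>(t - pi) / (2 * pi)\<rceil> :: real)"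
  have "c - 1 < (t - pi) / (2 * pi)" "(t - pi) / (2 * pi) \<le> c"
    unfolding c_def by linarith+
  then have "(c - 1) * (2 * pi) < t - pi" "t - pi \<le> c * (2 * pi)"
    by (simp_all add: pos_less_divide_eq pos_divide_le_eq)
  then show ?thesis
    unfolding reduce_angle_def c_def[symmetric] by (simp add: algebra_simps)
qed

lemma reduce_angle_congruent: "\<exists>k :: int. reduce_angle t = t + 2 * pi * of_int k"
  by (rule exI[of _ "- \<lceil>(t - pi) / (2 * pi)\<rceil>"]) (simp add: reduce_angle_def)

definition harmonic_frequency :: "real \<times> real \<Rightarrow> nat \<Rightarrow> real \<times> real" where
  "harmonic_frequency \<theta> \<alpha> =
     (reduce_angle (fst \<theta> + of_nat \<alpha> * pi), reduce_angle (snd \<theta> + of_nat \<alpha> * pi))"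

definition harmonics :: "real \<Rightarrow> real \<times> real \<Rightarrow> gfun set" where
  "harmonics h \<theta> =
     gfun.span {fourier_mode h (harmonic_frequency \<theta> 0), fourier_mode h (harmonic_frequency \<theta> 1)}"

(* The point relaxation enters only through its Fourier symbol on the points of the given color. *)
definition partial_step ::
  "real \<Rightarrow> int \<Rightarrow> (real \<times> real \<Rightarrow> complex) \<Rightarrow> (gfun \<Rightarrow> gfun) \<Rightarrow> bool" where
  "partial_step h \<beta> symb T \<longleftrightarrow>
     grid_operator h T \<and>
     (\<forall>u\<in>grid_functions h. \<forall>x\<in>grid h - color_grid h \<beta>. T u x = u x) \<and>
     (\<forall>\<theta>\<in>frequencies. \<forall>x\<in>grid h.
        T (fourier_mode h \<theta>) x =
          (if x \<in> color_grid h \<beta> then symb \<theta> * fourier_mode h \<theta> x else fourier_mode h \<theta> x))"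

definition two_color_step :: "(int \<Rightarrow> real \<Rightarrow> gfun \<Rightarrow> gfun) \<Rightarrow> real \<Rightarrow> gfun \<Rightarrow> gfun" where
  "two_color_step S \<omega> = S 1 \<omega> \<circ> S 0 \<omega>"

end

theory Submission
  imports Defs
begin

text \<open>The two frequencies that generate a space of \<open>2h\<close>-harmonics differ by \<open>(\<pi>, \<pi>)\<close> modulo
  \<open>2\<pi>\<close>. On the grid a shift by \<open>2\<pi>\<close> is invisible and a shift by \<open>(\<pi>, \<pi>)\<close> multiplies a mode by
  \<open>(-1)\<^sup>k\<close> with \<open>k = k\<^sub>1 + k\<^sub>2\<close>, so the two modes agree at the red points and are opposite at the
  black ones (\<open>fourier_mode_harmonic_frequency\<close>). Half their sum is therefore the restriction of
  either mode to the red points, half their difference the restriction to the black points, up to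
  sign: the space of harmonics contains both colored parts of its generators
  (\<open>color_part_in_harmonics\<close>).

  A partial step changes a mode only by adding a multiple of its part on one color
  (\<open>partial_step_fourier_mode\<close>). Hence it maps both generators into the space of harmonics, and,
  by linearity, the whole space; so does the composition of the two partial steps.\<close>

lemma exp_i_pi_int: "exp (\<i> * complex_of_real (pi * of_int n)) = (if even n then 1 else -1)"
proof -
  have "exp (\<i> * complex_of_real (pi * of_int n)) = cis (pi * of_int n)"
    by (simp add: cis_conv_exp)
  also have "\<dots> = (if even n then 1 else -1)"
    by (simp add: complex_eq_iff cos_npi_int sin_npi_int)
  finally show ?thesis .
qed

text \<open>Grid points have integer coordinates in units of the mesh size, so shifting the frequency by
  integer multiples of \<open>\<pi>\<close> only changes the phase by a multiple of \<open>\<pi>\<close>. The even multiples, which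
  reduction to the fundamental interval introduces, are not seen at all.\<close>

lemma fourier_mode_shift_pi:
  assumes "h > 0"
  shows "fourier_mode h (s + pi * of_int m, t + pi * of_int n) (of_int k * h, of_int l * h) =
    (if even (m * k + n * l) then 1 else -1) * fourier_mode h (s, t) (of_int k * h, of_int l * h)"
proof -
  have grid: "(of_int k * h, of_int l * h) \<in> grid h"
    by (auto simp: grid_def)
  have phase: "(s + pi * of_int m, t + pi * of_int n) \<bullet> (of_int k * h, of_int l * h) / h =
      pi * of_int (m * k + n * l) + (s, t) \<bullet> (of_int k * h, of_int l * h) / h"
    using assms by (simp add: inner_prod_def field_simps)
  show ?thesis
    unfolding fourier_mode_def if_P[OF grid] phase of_real_add distrib_left exp_add exp_i_pi_int ..
qed

lemma mem_color_grid_iff: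
  assumes "h > 0"
  shows "(of_int k * h, of_int l * h) \<in> color_grid h \<beta> \<longleftrightarrow> (k + l) mod 2 = \<beta> mod 2"
  using assms by (auto simp: color_grid_def)

lemma fourier_mode_harmonic_frequency:
  assumes "h > 0" and "x \<in> grid h"
  shows "fourier_mode h (harmonic_frequency \<theta> \<alpha>) x =
    (if even \<alpha> \<or> x \<in> color_grid h 0 then 1 else -1) * fourier_mode h \<theta> x"
proof -
  obtain k l :: int where x: "x = (of_int k * h, of_int l * h)"
    using assms(2) by (auto simp: grid_def)
  obtain m where m: "reduce_angle (fst \<theta> + of_nat \<alpha> * pi) = fst \<theta> + of_nat \<alpha> * pi + 2 * pi * of_int m"
    using reduce_angle_congruent by blast
  obtain n where n: "reduce_angle (snd \<theta> + of_nat \<alpha> * pi) = snd \<theta> + of_nat \<alpha> * pi + 2 * pi * of_int n"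
    using reduce_angle_congruent by blast
  have "harmonic_frequency \<theta> \<alpha> =
      (fst \<theta> + pi * of_int (int \<alpha> + 2 * m), snd \<theta> + pi * of_int (int \<alpha> + 2 * n))"
    unfolding harmonic_frequency_def m n by (simp add: algebra_simps)
  moreover have "even ((int \<alpha> + 2 * m) * k + (int \<alpha> + 2 * n) * l) \<longleftrightarrow>
      even \<alpha> \<or> x \<in> color_grid h 0"
    unfolding x mem_color_grid_iff[OF assms(1)] by (auto simp: even_iff_mod_2_eq_zero[symmetric])
  ultimately show ?thesis
    by (simp only: x fourier_mode_shift_pi[OF assms(1)] prod.collapse)
qed

definition color_part :: "real \<Rightarrow> int \<Rightarrow> gfun \<Rightarrow> gfun" where
  "color_part h \<beta> u = (\<lambda>x. if x \<in> color_grid h \<beta> then u x else 0)"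

lemma color_part_fourier_mode:
  assumes "h > 0" and "\<alpha> \<in> {0, 1}" and "\<beta> \<in> {0, 1}"
  shows "color_part h \<beta> (fourier_mode h (harmonic_frequency \<theta> \<alpha>)) =
    cscale (1/2) (fourier_mode h (harmonic_frequency \<theta> \<alpha>) +
      cscale (if \<beta> = 0 then 1 else -1) (fourier_mode h (harmonic_frequency \<theta> (1 - \<alpha>))))"
proof
  fix x
  show "color_part h \<beta> (fourier_mode h (harmonic_frequency \<theta> \<alpha>)) x =
    cscale (1/2) (fourier_mode h (harmonic_frequency \<theta> \<alpha>) +
      cscale (if \<beta> = 0 then 1 else -1) (fourier_mode h (harmonic_frequency \<theta> (1 - \<alpha>)))) x"
  proof (cases "x \<in> grid h")
    case True
    have "x \<in> color_grid h 1 \<longleftrightarrow> x \<notin> color_grid h 0"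
      using True mem_color_grid_iff[OF assms(1)] by (auto simp: grid_def)
    then show ?thesis
      using assms(2,3)
      by (auto simp: color_part_def cscale_def fourier_mode_harmonic_frequency[OF assms(1) True])
  next
    case False
    then show ?thesis
      by (simp add: color_part_def cscale_def fourier_mode_def)
  qed
qed

lemma color_part_in_harmonics:
  assumes "h > 0" and "\<alpha> \<in> {0, 1}" and "\<beta> \<in> {0, 1}"
  shows "color_part h \<beta> (fourier_mode h (harmonic_frequency \<theta> \<alpha>)) \<in> harmonics h \<theta>"
proof -
  have "fourier_mode h (harmonic_frequency \<theta> \<gamma>) \<in> harmonics h \<theta>" if "\<gamma> \<in> {0, 1}" for \<gamma>
    using that by (auto simp: harmonics_def intro: gfun.span_base)
  moreover have "1 - \<alpha> \<in> {0, 1}"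
    using assms(2) by auto
  ultimately show ?thesis
    unfolding color_part_fourier_mode[OF assms] using assms(2)
    by (auto simp: harmonics_def intro!: gfun.span_scale gfun.span_add gfun.span_diff)
qed

text \<open>Off the grid both sides vanish, because a partial step maps grid functions to grid functions;
  this is what turns the pointwise description of the step into an equality of functions.\<close>

lemma partial_step_fourier_mode:
  assumes "partial_step h \<beta> symb T" and "\<theta> \<in> frequencies"
  shows "T (fourier_mode h \<theta>) =
    fourier_mode h \<theta> + cscale (symb \<theta> - 1) (color_part h \<beta> (fourier_mode h \<theta>))"
proof
  fix x
  have "T (fourier_mode h \<theta>) \<in> grid_functions h"
    using assms(1) fourier_mode_in_grid_functions by (simp add: partial_step_def grid_operator_def)
  then show "T (fourier_mode h \<theta>) x =
      (fourier_mode h \<theta> + cscale (symb \<theta> - 1) (color_part h \<beta> (fourier_mode h \<theta>))) x"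
    using assms fourier_mode_in_grid_functions[of h \<theta>]
    by (cases "x \<in> grid h")
      (cases x; auto simp: partial_step_def grid_functions_def color_part_def cscale_def
        algebra_simps)+
qed

lemma grid_operator_span_subset:
  assumes T: "grid_operator h T" and B: "B \<subseteq> grid_functions h"
    and V: "gfun.subspace V" and TB: "T ` B \<subseteq> V"
  shows "T ` gfun.span B \<subseteq> V"
proof -
  have zero: "(0 :: gfun) \<in> grid_functions h"
    by (rule gfun.subspace_0[OF subspace_grid_functions])
  have "T (cscale 0 0) = cscale 0 (T 0)"
    using T zero by (simp only: grid_operator_def)
  then have T0: "T 0 = 0"
    by (simp add: cscale_def fun_eq_iff zero_fun_def)
  have "gfun.subspace {u \<in> grid_functions h. T u \<in> V}"
    using T V subspace_grid_functions[of h] T0 unfolding gfun.subspace_def grid_operator_def by auto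
  then have "gfun.span B \<subseteq> {u \<in> grid_functions h. T u \<in> V}"
    using B TB by (intro gfun.span_minimal) auto
  then show ?thesis
    by auto
qed

lemma harmonic_frequency_in_frequencies: "harmonic_frequency \<theta> \<alpha> \<in> frequencies"
  unfolding harmonic_frequency_def frequencies_def using reduce_angle_range by blast

text \<open>Already the single partial steps leave the harmonics invariant, so invariance
  does not depend on the order in which the colors are relaxed.\<close>

lemma partial_step_harmonics:
  assumes "h > 0" and "\<beta> \<in> {0, 1}" and step: "partial_step h \<beta> symb T"
  shows "T ` harmonics h \<theta> \<subseteq> harmonics h \<theta>"
proof -
  have "T (fourier_mode h (harmonic_frequency \<theta> \<alpha>)) \<in> harmonics h \<theta>" if "\<alpha> \<in> {0, 1}" for \<alpha>
  proof -
    have "fourier_mode h (harmonic_frequency \<theta> \<alpha>) \<in> harmonics h \<theta>"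
      using that by (auto simp: harmonics_def intro: gfun.span_base)
    with color_part_in_harmonics[OF assms(1) that assms(2), of \<theta>] show ?thesis
      unfolding partial_step_fourier_mode[OF step harmonic_frequency_in_frequencies]
      by (auto simp: harmonics_def intro!: gfun.span_add gfun.span_scale)
  qed
  moreover have "grid_operator h T"
    using step by (simp add: partial_step_def)
  ultimately show ?thesis
    unfolding harmonics_def
    by (intro grid_operator_span_subset)
      (auto simp: fourier_mode_in_grid_functions)
qed

theorem theorem2:
  fixes h \<omega> :: real
    and S :: "int \<Rightarrow> real \<Rightarrow> gfun \<Rightarrow> gfun"
    and symb :: "int \<Rightarrow> real \<times> real \<Rightarrow> real \<Rightarrow> complex"
  assumes "h > 0"
    and "\<And>\<beta>. \<beta> \<in> {0, 1} \<Longrightarrow> partial_step h \<beta> (\<lambda>\<theta>. symb \<beta> \<theta> \<omega>) (S \<beta> \<omega>)"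
  shows "\<forall>\<theta>\<in>low_frequencies. two_color_step S \<omega> ` harmonics h \<theta> \<subseteq> harmonics h \<theta>"
proof
  fix \<theta>
  have "S \<beta> \<omega> ` harmonics h \<theta> \<subseteq> harmonics h \<theta>" if "\<beta> \<in> {0, 1}" for \<beta>
    using partial_step_harmonics[OF assms(1) that assms(2)[OF that]] .
  from this[of 0] this[of 1]
  show "two_color_step S \<omega> ` harmonics h \<theta> \<subseteq> harmonics h \<theta>"
    by (auto simp: two_color_step_def)
qed

end
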